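(* Let $q\in\mathbf C$ with $|q|<1$ and $\omega=e^{2\pi i/3}$. Then $$\left(\sum_{m,n\in\mathbf Z}\omega^{m-n}q^{m^2+mn+n^2}\right)^3+\left(3\sum_{m,n\in\mathbf Z}q^{3((m+1/3)^2+(m+1/3)n+n^2)}\right)^3=\left(\sum_{m,n\in\mathbf Z}q^{m^2+mn+n^2}\right)^3$$ and $$\left(\sum_{m,n\in\mathbf Z}\omega^{m-n}q^{3m^2+3mn+n^2}\right)^3+\left(\sum_{m,n\in\mathbf Z}q^{3(3(m+1/3)^2+3(m+1/3)n+n^2)}\right)^3=\left(\sum_{m,n\in\mathbf Z}q^{3(3m^2+3mn+n^2)}\right)^3.$$
   Context: Fractional powers of $q$ (with exponents in $\tfrac13\mathbf Z$) are formed using one fixed cube root $q^{1/3}$ of $q$, i.e. $q^{k/3}=(q^{1/3})^k$ (and $0^0=1$). *)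

theory Defs
  imports "HOL-Analysis.Analysis"
begin

text \<open>
  The power \<open>q\<^sup>e\<close> for an exponent \<open>e\<close> with \<open>3 * e\<close> an integer, formed with the cube root
  \<open>r\<close> of \<open>q\<close>: it is \<open>r\<close> to the integer power \<open>3 * e\<close>. For such \<open>e\<close> the floor only
  converts the type; other exponents are not meaningful.
\<close>

definition third_pow :: "complex \<Rightarrow> rat \<Rightarrow> complex" where
  "third_pow r e = r powi \<lfloor>3 * e\<rfloor>"

end

theory Submission
  imports Defs
begin

text \<open>Write \<open>L\<close> for the Eisenstein integers and \<open>\<theta> = \<surd>-3\<close>, and let the first identity read
  \<open>b(q)\<^sup>3 + c(q)\<^sup>3 = a(q)\<^sup>3\<close>. By the symmetry \<open>x \<mapsto> -x\<close>, the difference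
  \<open>a(q)\<^sup>3 - b(q)\<^sup>3\<close> is three times the sum of \<open>q\<close> to the norm over the triples \<open>(x, y, z)\<close> in \<open>L\<^sup>3\<close> with
  \<open>x + y + z \<equiv> 1\<close> modulo \<open>\<theta>\<close>. The discrete Fourier transform on three points, divided by \<open>\<theta>\<close>, is
  unitary and maps these triples onto the \<open>(u, v, w)\<close> in \<open>(1/\<theta> + L)\<^sup>3\<close> with \<open>u + v + w \<in> \<theta>L\<close>.
  Multiplying \<open>u\<close> by \<open>\<omega>\<close> permutes the three classes of \<open>u + v + w\<close> modulo \<open>\<theta>\<close>, so the sum over one class is
  a third of \<open>c(q)\<^sup>3\<close>. The second identity is the first one with \<open>q\<^sup>3\<close> in place of \<open>q\<close>.\<close>

section \<open>Unconditional sums: residue classes, products, cubes\<close>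

lemma infsum_mod3_split:
  fixes f :: "'a \<Rightarrow> complex" and g :: "'a \<Rightarrow> int"
  assumes f: "f summable_on A"
  shows "infsum f A = infsum f {x \<in> A. g x mod 3 = 0} + infsum f {x \<in> A. g x mod 3 = 1}
           + infsum f {x \<in> A. g x mod 3 = 2}"
proof -
  have A: "A = ({x \<in> A. g x mod 3 = 0} \<union> {x \<in> A. g x mod 3 = 1}) \<union> {x \<in> A. g x mod 3 = 2}"
    by (auto; presburger)
  have s: "f summable_on B" if "B \<subseteq> A" for B
    using summable_on_subset_banach[OF f that] .
  show ?thesis
    by (subst A, subst infsum_Un_disjoint, blast intro: s, blast intro: s, force,
        subst infsum_Un_disjoint) (auto intro!: s)
qed

lemma
  fixes f :: "'a \<Rightarrow> complex" and g :: "'b \<Rightarrow> complex"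
  assumes f: "(\<lambda>x. norm (f x)) summable_on A" and g: "(\<lambda>y. norm (g y)) summable_on B"
  shows abs_summable_on_Times_mult: "(\<lambda>p. norm (case p of (x, y) \<Rightarrow> f x * g y)) summable_on A \<times> B" (is ?s)
    and infsum_Times_mult: "infsum (\<lambda>(x, y). f x * g y) (A \<times> B) = infsum f A * infsum g B"
proof -
  show s: ?s
  proof (subst Infinite_Sum.abs_summable_on_Sigma_iff, intro conjI ballI)
    show "(\<lambda>y. norm (case (x, y) of (x, y) \<Rightarrow> f x * g y)) summable_on B" for x
      using g by (simp add: norm_mult summable_on_cmult_right)
    have "(\<lambda>x. norm (f x) * infsum (\<lambda>y. norm (g y)) B) summable_on A"
      using f by (rule summable_on_cmult_left)
    moreover have "0 \<le> infsum (\<lambda>y. norm (g y)) B"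
      by (simp add: infsum_nonneg)
    ultimately show "(\<lambda>x. norm (\<Sum>\<^sub>\<infinity>y\<in>B. norm (case (x, y) of (x, y) \<Rightarrow> f x * g y))) summable_on A"
      by (simp only: prod.case norm_mult infsum_cmult_right' real_norm_def abs_mult abs_norm_cancel abs_of_nonneg)
  qed
  show "infsum (\<lambda>(x, y). f x * g y) (A \<times> B) = infsum f A * infsum g B"
    using infsum_Sigma_banach[OF abs_summable_summable[OF s]]
    by (simp only: prod.case infsum_cmult_right' infsum_cmult_left')
qed

lemma
  fixes f :: "'a \<Rightarrow> complex"
  assumes f: "(\<lambda>x. norm (f x)) summable_on A"
  shows summable_on_triple_mult: "(\<lambda>(x, y, z). f x * f y * f z) summable_on A \<times> A \<times> A" (is ?s)
    and infsum_cube: "infsum f A ^ 3 = infsum (\<lambda>(x, y, z). f x * f y * f z) (A \<times> A \<times> A)" (is ?e)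
proof -
  note ff = abs_summable_on_Times_mult[OF f f]
  have eq: "(\<lambda>(x, y, z). f x * f y * f z) = (\<lambda>(x, yz). f x * (case yz of (y, z) \<Rightarrow> f y * f z))"
    by (auto simp: fun_eq_iff)
  show ?s
    unfolding eq by (rule abs_summable_summable[OF abs_summable_on_Times_mult[OF f ff]])
  show ?e
    unfolding eq by (subst infsum_Times_mult[OF f ff], subst infsum_Times_mult[OF f f])
      (simp add: power3_eq_cube)
qed

lemma summable_on_int_geometric:
  fixes s :: real
  assumes "0 \<le> s" "s < 1"
  shows "(\<lambda>k :: int. s ^ nat \<bar>k\<bar>) summable_on UNIV"
proof -
  have nat: "(\<lambda>n :: nat. s ^ n) summable_on UNIV"
    using assms by (subst summable_on_UNIV_nonneg_real_iff) auto
  have "(\<lambda>k :: int. s ^ nat \<bar>k\<bar>) summable_on {0..} \<longleftrightarrow> (\<lambda>n :: nat. s ^ n) summable_on UNIV"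
    by (rule summable_on_reindex_bij_witness[of _ int nat]) auto
  moreover have "(\<lambda>k :: int. s ^ nat \<bar>k\<bar>) summable_on {..0} \<longleftrightarrow> (\<lambda>n :: nat. s ^ n) summable_on UNIV"
    by (rule summable_on_reindex_bij_witness[of _ "\<lambda>n. - int n" "\<lambda>k. nat (- k)"]) auto
  ultimately have "(\<lambda>k :: int. s ^ nat \<bar>k\<bar>) summable_on {0..} \<union> {..0}"
    using nat by (intro summable_on_union) auto
  moreover have "{0..} \<union> {..0} = (UNIV :: int set)" by auto
  ultimately show ?thesis by simp
qed

section \<open>Eisenstein integers and convergence of their norm series\<close>

text \<open>The pair \<open>(m, n)\<close> stands for the Eisenstein integer \<open>m - n\<omega>\<close>; its residue modulo
  \<open>\<theta> = 1 + 2\<omega>\<close> is \<open>m - n\<close> modulo 3, and \<open>rot\<close> is multiplication by \<open>\<omega>\<close>.\<close>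

definition eis_norm :: "int \<times> int \<Rightarrow> int" where
  "eis_norm x = (fst x)\<^sup>2 + fst x * snd x + (snd x)\<^sup>2"

definition eis_res :: "int \<times> int \<Rightarrow> int" where
  "eis_res x = fst x - snd x"

definition rot :: "int \<times> int \<Rightarrow> int \<times> int" where
  "rot x = (snd x, - (fst x + snd x))"

definition eis_term :: "complex \<Rightarrow> int \<times> int \<Rightarrow> complex" where
  "eis_term q x = q ^ nat (eis_norm x)"

lemma eis_norm_nonneg: "eis_norm x \<ge> 0"
proof -
  have "2 * eis_norm x = (fst x)\<^sup>2 + (snd x)\<^sup>2 + (fst x + snd x)\<^sup>2"
    by (simp add: eis_norm_def power2_eq_square algebra_simps)
  moreover have "0 \<le> (fst x)\<^sup>2 + (snd x)\<^sup>2 + (fst x + snd x)\<^sup>2"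
    by (intro add_nonneg_nonneg) simp_all
  ultimately show ?thesis by linarith
qed

lemma eis_norm_rot [simp]: "eis_norm (rot x) = eis_norm x"
  by (simp add: eis_norm_def rot_def power2_eq_square algebra_simps)

lemma eis_res_rot: "eis_res (rot x) mod 3 = eis_res x mod 3"
proof -
  have "eis_res (rot x) = eis_res x + 3 * snd x"
    by (simp add: eis_res_def rot_def)
  then show ?thesis by simp
qed

lemma eis_term_rot [simp]: "eis_term q (rot x) = eis_term q x"
  by (simp add: eis_term_def)

lemma rot_rot_rot [simp]: "rot (rot (rot x)) = x"
  by (simp add: rot_def)

lemma powi_eis_norm: "q powi eis_norm x = eis_term q x"
  using eis_norm_nonneg[of x] by (simp add: eis_term_def power_int_def)

lemma eis_term_mult3:
  "eis_term q x * eis_term q y * eis_term q z = q ^ nat (eis_norm x + eis_norm y + eis_norm z)"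
  using eis_norm_nonneg[of x] eis_norm_nonneg[of y] eis_norm_nonneg[of z]
  by (simp add: eis_term_def nat_add_distrib power_add)

text \<open>Twice the norm is \<open>m^2 + n^2 + (m + n)^2\<close>, hence at least
  \<open>\<bar>m\<bar> + \<bar>n\<bar>\<close>. With \<open>s\<close> the square root of
  \<open>norm q\<close>, the product of two geometric series in \<open>s\<close> dominates.\<close>

lemma eis_term_abs_summable:
  assumes "norm q < 1"
  shows "(\<lambda>x. norm (eis_term q x)) summable_on A"
proof -
  define s where "s = sqrt (norm q)"
  have s: "0 \<le> s" "s < 1" "norm q = s ^ 2"
    using assms by (auto simp: s_def)
  define c where "c = (\<lambda>k :: int. complex_of_real (s ^ nat \<bar>k\<bar>))"
  have c: "(\<lambda>k. norm (c k)) summable_on UNIV"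
    using summable_on_int_geometric[OF s(1,2)] s(1) by (simp add: c_def norm_power)
  have abs_le: "\<bar>k\<bar> \<le> k\<^sup>2" for k :: int
    by (cases "k = 0") (use mult_left_mono[of 1 "\<bar>k\<bar>" "\<bar>k\<bar>"] in \<open>auto simp: power2_eq_square\<close>)
  have "(\<lambda>x. norm (eis_term q x)) summable_on UNIV"
  proof (rule Infinite_Sum.abs_summable_on_comparison_test)
    show "(\<lambda>p. norm (case p of (x, y) \<Rightarrow> c x * c y)) summable_on UNIV"
      using abs_summable_on_Times_mult[OF c c] by simp
  next
    fix x :: "int \<times> int"
    obtain m n where x: "x = (m, n)" by force
    have "2 * eis_norm x = m\<^sup>2 + n\<^sup>2 + (m + n)\<^sup>2"
      by (simp add: x eis_norm_def power2_eq_square algebra_simps)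
    then have "\<bar>m\<bar> + \<bar>n\<bar> \<le> 2 * eis_norm x"
      using abs_le[of m] abs_le[of n] zero_le_power2[of "m + n"] by linarith
    then have "nat \<bar>m\<bar> + nat \<bar>n\<bar> \<le> 2 * nat (eis_norm x)" by linarith
    then have "s ^ (2 * nat (eis_norm x)) \<le> s ^ (nat \<bar>m\<bar> + nat \<bar>n\<bar>)"
      using s by (intro power_decreasing) auto
    then show "norm (eis_term q x) \<le> norm (case x of (x, y) \<Rightarrow> c x * c y)"
      using s by (simp add: x eis_term_def c_def norm_mult norm_power power_add power_mult)
  qed
  then show ?thesis by (rule summable_on_subset_banach) auto
qed

lemma eis_term_summable: "norm q < 1 \<Longrightarrow> eis_term q summable_on A"
  by (rule abs_summable_summable[OF eis_term_abs_summable])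

section \<open>Cubes of the theta functions as sums over triples\<close>

definition theta_a :: "complex \<Rightarrow> complex" where
  "theta_a q = infsum (eis_term q) UNIV"

definition theta_b :: "complex \<Rightarrow> complex \<Rightarrow> complex" where
  "theta_b w q = (\<Sum>\<^sub>\<infinity>x. w powi eis_res x * eis_term q x)"

text \<open>The classical \<open>c(q)\<close> sums over the coset \<open>1/\<theta>\<close> of the Eisenstein integers; scaling by \<open>\<theta>\<close>
  makes the argument a cube root \<open>r\<close> of \<open>q\<close> and the index set integral.\<close>

definition theta_c :: "complex \<Rightarrow> complex" where
  "theta_c r = infsum (eis_term r) {x. eis_res x mod 3 = 1}"

definition triple_term :: "complex \<Rightarrow> (int \<times> int) \<times> (int \<times> int) \<times> (int \<times> int) \<Rightarrow> complex" where
  "triple_term q = (\<lambda>(x, y, z). eis_term q x * eis_term q y * eis_term q z)"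

definition triple_res :: "(int \<times> int) \<times> (int \<times> int) \<times> (int \<times> int) \<Rightarrow> int" where
  "triple_res = (\<lambda>(x, y, z). eis_res x + eis_res y + eis_res z)"

definition triple_fst :: "(int \<times> int) \<times> (int \<times> int) \<times> (int \<times> int) \<Rightarrow> int" where
  "triple_fst = (\<lambda>(x, y, z). fst x + fst y + fst z)"

abbreviation res_one :: "(int \<times> int) set" where
  "res_one \<equiv> {x. eis_res x mod 3 = 1}"

text \<open>Three entries of residue 1 have a sum whose two coordinates agree modulo 3, so its first
  coordinate fixes its class modulo 3. Before the scaling by \<theta> this is the class of
  \<open>u + v + w\<close> modulo \<theta>. Reducing \<open>k\<close> makes the index
  cyclic.\<close>

definition one_triples :: "int \<Rightarrow> ((int \<times> int) \<times> (int \<times> int) \<times> (int \<times> int)) set" where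
  "one_triples k = {t \<in> res_one \<times> res_one \<times> res_one. triple_fst t mod 3 = k mod 3}"

lemma powi_mod3:
  fixes w :: complex
  assumes "w ^ 3 = 1"
  shows "w powi k = w powi (k mod 3)"
proof -
  have "w \<noteq> 0" using assms by auto
  have "w powi k = w powi (3 * (k div 3) + k mod 3)" by simp
  also have "\<dots> = w powi (3 * (k div 3)) * w powi (k mod 3)"
    using \<open>w \<noteq> 0\<close> by (subst power_int_add) auto
  also have "w powi (3 * (k div 3)) = 1"
    using assms by (simp add: power_int_mult)
  finally show ?thesis by simp
qed

lemma powi_cong_mod3: "w ^ 3 = 1 \<Longrightarrow> a mod 3 = b mod 3 \<Longrightarrow> w powi a = w powi b" for w :: complex
  by (metis powi_mod3)

lemma norm_eq_1_of_cube_eq_1: "w ^ 3 = 1 \<Longrightarrow> norm w = 1" for w :: complex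
proof -
  assume "w ^ 3 = 1"
  then have "norm w ^ 3 = 1 ^ 3" by (simp flip: norm_power)
  then show ?thesis using power_eq_imp_eq_base[of "norm w" 3 1] by simp
qed

lemma triple_term_summable: "norm q < 1 \<Longrightarrow> triple_term q summable_on A"
  using summable_on_subset_banach[OF summable_on_triple_mult[OF eis_term_abs_summable[of q UNIV]], of A]
  by (simp add: triple_term_def)

lemma theta_a_cube:
  assumes "norm q < 1"
  shows "theta_a q ^ 3 = infsum (triple_term q) {t. triple_res t mod 3 = 0}
    + infsum (triple_term q) {t. triple_res t mod 3 = 1}
    + infsum (triple_term q) {t. triple_res t mod 3 = 2}"
  using infsum_mod3_split[OF triple_term_summable[OF assms, of UNIV], of triple_res]
    infsum_cube[OF eis_term_abs_summable[OF assms, of UNIV]]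
  by (simp add: theta_a_def triple_term_def)

text \<open>The weights of a triple multiply to \<open>w powi triple_res t\<close>, which is
  constant on each residue class because \<open>w\<close> is a cube root of unity.\<close>

lemma theta_b_cube:
  assumes "norm q < 1" "w ^ 3 = 1"
  shows "theta_b w q ^ 3 = infsum (triple_term q) {t. triple_res t mod 3 = 0}
    + w * infsum (triple_term q) {t. triple_res t mod 3 = 1}
    + w ^ 2 * infsum (triple_term q) {t. triple_res t mod 3 = 2}"
proof -
  have w0: "w \<noteq> 0" using assms by auto
  have "(\<lambda>x. norm (w powi eis_res x * eis_term q x)) summable_on UNIV"
    using eis_term_abs_summable[OF assms(1), of UNIV] norm_eq_1_of_cube_eq_1[OF assms(2)]
    by (simp add: norm_mult norm_power_int)
  note s = summable_on_triple_mult[OF this] infsum_cube[OF this]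
  let ?h = "\<lambda>t. w powi triple_res t * triple_term q t"
  have eq: "(\<lambda>(x, y, z). w powi eis_res x * eis_term q x * (w powi eis_res y * eis_term q y)
      * (w powi eis_res z * eis_term q z)) = ?h"
    using w0 by (auto simp: fun_eq_iff triple_res_def triple_term_def power_int_add)
  have part: "infsum ?h {t. triple_res t mod 3 = k} = w powi k * infsum (triple_term q) {t. triple_res t mod 3 = k}" for k
    unfolding infsum_cmult_right'[symmetric]
    by (rule infsum_cong) (use powi_mod3[OF assms(2)] in auto)
  show ?thesis
    using s infsum_mod3_split[of ?h UNIV triple_res]
    by (simp add: eq part theta_b_def)
qed

text \<open>Negation preserves the norms and exchanges the residues 1 and 2.\<close>

lemma triple_res_2_eq_1:
  "infsum (triple_term q) {t. triple_res t mod 3 = 2} = infsum (triple_term q) {t. triple_res t mod 3 = 1}"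
proof (rule infsum_reindex_bij_witness[of _ uminus uminus])
  have res: "triple_res (- t) = - triple_res t" for t
    by (simp add: triple_res_def eis_res_def split: prod.split)
  have neg_mod: "(- k) mod 3 = 1 \<longleftrightarrow> k mod 3 = 2" "(- k) mod 3 = 2 \<longleftrightarrow> k mod 3 = 1" for k :: int
    by presburger+
  fix t :: "(int \<times> int) \<times> (int \<times> int) \<times> (int \<times> int)"
  show "- t \<in> {t. triple_res t mod 3 = 1}" if "t \<in> {t. triple_res t mod 3 = 2}"
    using that by (simp add: res neg_mod)
  show "- t \<in> {t. triple_res t mod 3 = 2}" if "t \<in> {t. triple_res t mod 3 = 1}"
    using that by (simp add: res neg_mod)
  show "triple_term q (- t) = triple_term q t"
    by (simp add: triple_term_def eis_term_def eis_norm_def split: prod.split)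
qed simp_all

lemma theta_c_cube_split:
  assumes "norm r < 1"
  shows "theta_c r ^ 3 = infsum (triple_term r) (one_triples 0)
    + infsum (triple_term r) (one_triples 1)
    + infsum (triple_term r) (one_triples 2)"
  using infsum_mod3_split[OF triple_term_summable[OF assms, of "res_one \<times> res_one \<times> res_one"], of triple_fst]
    infsum_cube[OF eis_term_abs_summable[OF assms, of res_one]]
  by (simp add: theta_c_def triple_term_def one_triples_def)

text \<open>The first coordinate of \<open>rot x\<close> is
  \<open>snd x = fst x - eis_res x\<close>, that is \<open>fst x - 1\<close> modulo 3. The summand
  \<open>k\<close> makes room for the other entries of a triple.\<close>

lemma res_one_rot:
  assumes "x \<in> res_one"
  shows "rot x \<in> res_one" "(fst (rot x) + k) mod 3 = (fst x + k - 1) mod 3"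
  using assms unfolding mem_Collect_eq eis_res_def rot_def fst_conv snd_conv by presburger+

lemma infsum_one_triples_shift:
  "infsum (triple_term r) (one_triples k) = infsum (triple_term r) (one_triples (k - 1))"
proof (rule infsum_reindex_bij_witness[of _ "map_prod (\<lambda>x. rot (rot x)) id" "map_prod rot id"])
  have rot: "map_prod rot id t \<in> one_triples (l - 1)" if t: "t \<in> one_triples l" for t l
  proof -
    obtain x y z where xyz: "t = (x, y, z)" by (metis surj_pair)
    have x: "x \<in> res_one" and yz: "y \<in> res_one" "z \<in> res_one"
      and l: "(fst x + (fst y + fst z)) mod 3 = l mod 3"
      using t by (simp_all add: xyz one_triples_def triple_fst_def add.assoc)
    have "(fst (rot x) + (fst y + fst z)) mod 3 = (l - 1) mod 3"
      by (rule trans[OF res_one_rot(2)[OF x] mod_diff_cong[OF l refl]])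
    then show ?thesis
      using res_one_rot(1)[OF x] yz by (simp add: xyz one_triples_def triple_fst_def add.assoc)
  qed
  show "map_prod rot id t \<in> one_triples (k - 1)" if "t \<in> one_triples k" for t
    using rot[OF that] .
  show "map_prod (\<lambda>x. rot (rot x)) id t \<in> one_triples k" if "t \<in> one_triples (k - 1)" for t
  proof -
    \<comment> \<open>The inverse of \<open>rot\<close> is \<open>rot\<close> applied twice; it
      lowers the class by two more, and \<open>k - 3\<close> is the same class as
      \<open>k\<close>.\<close>
    have "map_prod rot id (map_prod rot id t) \<in> one_triples (k - 1 - 1 - 1)"
      using rot[OF rot[OF that]] .
    moreover have "(k - 1 - 1 - 1) mod 3 = k mod 3" by presburger
    then have "one_triples (k - 1 - 1 - 1) = one_triples k"
      by (simp only: one_triples_def)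
    ultimately show ?thesis
      by (simp add: map_prod_def case_prod_unfold)
  qed
qed (auto simp: triple_term_def)

lemma theta_c_cube:
  assumes "norm r < 1"
  shows "theta_c r ^ 3 = 3 * infsum (triple_term r) (one_triples 0)"
  using theta_c_cube_split[OF assms] infsum_one_triples_shift[of r 2] infsum_one_triples_shift[of r 1]
  by simp

section \<open>The Fourier transform on three points and the cubic identity\<close>

text \<open>The map \<open>(x, y, z) \<mapsto> (x + y + z, x + \<omega>y + \<omega>\<^sup>2z, x + \<omega>\<^sup>2y + \<omega>z)\<close>, which is
  \<open>\<surd>3\<close> times a unitary map.\<close>

definition triple_dft :: "(int \<times> int) \<times> (int \<times> int) \<times> (int \<times> int) \<Rightarrow> (int \<times> int) \<times> (int \<times> int) \<times> (int \<times> int)" where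
  "triple_dft = (\<lambda>((x1, x2), (y1, y2), (z1, z2)).
     ((x1 + y1 + z1, x2 + y2 + z2),
      (x1 + y2 - (z1 + z2), x2 - (y1 + y2) + z1),
      (x1 - (y1 + y2) + z2, x2 + y1 - (z1 + z2))))"

text \<open>The inverse is the conjugate transform divided by 3; on the image each
  \<open>div\<close> is exact.\<close>

lemma inj_triple_dft: "inj triple_dft"
proof (rule inj_on_inverseI)
  show "(\<lambda>((u1, u2), (v1, v2), (w1, w2)).
     (((u1 + v1 + w1) div 3, (u2 + v2 + w2) div 3),
      ((u1 - (v1 + v2) + w2) div 3, (u2 + v1 - (w1 + w2)) div 3),
      ((u1 + v2 - (w1 + w2)) div 3, (u2 - (v1 + v2) + w1) div 3))) (triple_dft t) = t" for t
    by (simp add: triple_dft_def split: prod.split)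
qed

text \<open>Parseval: the transform multiplies the total norm by 3.\<close>

lemma triple_term_dft: "triple_term r (triple_dft t) = triple_term (r ^ 3) t"
proof -
  obtain x1 x2 y1 y2 z1 z2 where t: "t = ((x1, x2), (y1, y2), (z1, z2))"
    by (metis surj_pair)
  obtain u v w where d: "triple_dft t = (u, v, w)" by (metis surj_pair)
  have "eis_norm u + eis_norm v + eis_norm w
      = 3 * (eis_norm (x1, x2) + eis_norm (y1, y2) + eis_norm (z1, z2))"
    using d unfolding t triple_dft_def prod.case prod.inject
    by (elim conjE, hypsubst) (simp add: eis_norm_def power2_eq_square algebra_simps)
  moreover have "nat (3 * k) = 3 * nat k" for k :: int by simp
  ultimately show ?thesis
    unfolding d unfolding t
    by (simp only: triple_term_def prod.case eis_term_mult3 power_mult)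
qed

text \<open>As \<omega> is 1 modulo \<theta>, each component of the transform is congruent to
  \<open>x + y + z\<close> modulo \<theta>, and the components add up to
  \<open>3 * x\<close>.\<close>

lemma image_triple_dft: "triple_dft ` {t. triple_res t mod 3 = 1} = one_triples 0"
  (is "_ ` ?S = ?T")
proof (intro equalityI subsetI)
  have shift: "b mod 3 = 1" if "a mod 3 = 1" "b = a + 3 * k" for a b k :: int
    using that by simp
  fix t assume "t \<in> triple_dft ` ?S"
  then obtain x1 x2 y1 y2 z1 z2 where t: "t = triple_dft ((x1, x2), (y1, y2), (z1, z2))"
    and res: "(x1 - x2 + (y1 - y2) + (z1 - z2)) mod 3 = 1"
    by (auto simp: triple_res_def eis_res_def)
  show "t \<in> ?T"
    unfolding t mem_Collect_eq mem_Times_iff one_triples_def triple_dft_def triple_fst_def eis_res_def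
      prod.case fst_conv snd_conv
    by (intro conjI; (rule shift[OF res, of _ 0] shift[OF res, of _ "y2 - z1"] shift[OF res, of _ "z2 - y1"])?)
      simp_all
next
  fix t assume t: "t \<in> ?T"
  obtain u1 u2 v1 v2 w1 w2 where tt: "t = ((u1, u2), (v1, v2), (w1, w2))"
    by (metis surj_pair)
  have h: "(u1 - u2) mod 3 = 1" "(v1 - v2) mod 3 = 1" "(w1 - w2) mod 3 = 1"
    "(u1 + v1 + w1) mod 3 = 0"
    using t by (simp_all add: tt one_triples_def triple_fst_def eis_res_def add.assoc)
  obtain a b c d where
    "u1 - u2 = 3 * a + 1" "v1 - v2 = 3 * b + 1" "w1 - w2 = 3 * c + 1" "u1 + v1 + w1 = 3 * d + 0"
    using h by (metis mult_div_mod_eq)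
  then have e: "u1 = 3 * d - v1 - w1" "v2 = v1 - 1 - 3 * b" "w2 = w1 - 1 - 3 * c"
    "u2 = 3 * d - v1 - w1 - 1 - 3 * a"
    by linarith+
  \<comment> \<open>This is the inverse transform of \<open>t\<close> with the divisions by 3
    carried out. Its entries add up to the first component of \<open>t\<close>, so its residue is
    \<open>u1 - u2\<close>.\<close>
  let ?s = "((d, d - 1 - a - b - c), (d - v1 + b - c, d - w1 - a + c), (d - w1 - b + c, d - v1 - a + b))"
  have "t = triple_dft ?s"
    by (simp add: tt triple_dft_def e)
  moreover have "triple_res ?s = 1 + 3 * a"
    by (simp add: triple_res_def eis_res_def)
  then have "?s \<in> ?S" by simp
  ultimately show "t \<in> triple_dft ` ?S" by blast
qed

theorem cubic_theta_identity:
  assumes "norm r < 1" "w ^ 3 = 1" "w \<noteq> 1"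
  shows "theta_b w (r ^ 3) ^ 3 + theta_c r ^ 3 = theta_a (r ^ 3) ^ 3"
proof -
  have q: "norm (r ^ 3) < 1"
    using assms(1) by (simp add: norm_power power_less_one_iff)
  define T where "T = infsum (triple_term (r ^ 3)) {t. triple_res t mod 3 = 1}"
  have "(w - 1) * (1 + w + w ^ 2) = 0"
    using assms(2) by (simp add: power2_eq_square power3_eq_cube algebra_simps)
  then have w: "w + w ^ 2 = - 1"
    using assms(3) by (simp add: add_eq_0_iff add.assoc)
  have "theta_c r ^ 3 = 3 * infsum (triple_term r) (triple_dft ` {t. triple_res t mod 3 = 1})"
    using theta_c_cube[OF assms(1)] by (simp only: image_triple_dft)
  also have "\<dots> = 3 * T"
    by (subst infsum_reindex) (auto intro: inj_on_subset[OF inj_triple_dft] simp: o_def triple_term_dft T_def)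
  finally have c: "theta_c r ^ 3 = 3 * T" .
  \<comment> \<open>With \<open>S\<close> the sum over the triples of residue 0, the cubes of
    \<open>theta_a\<close>, \<open>theta_b\<close> and \<open>theta_c\<close> are
    \<open>S + 2 * T\<close>, \<open>S - T\<close> and \<open>3 * T\<close>.\<close>
  have "w * T + w ^ 2 * T = - T"
    by (simp flip: distrib_right add: w)
  then show ?thesis
    using theta_a_cube[OF q] theta_b_cube[OF q assms(2)] c
    by (simp add: triple_res_2_eq_1 flip: T_def)
qed

section \<open>The sums of the statement as theta functions\<close>

lemma third_pow_eis_norm:
  assumes "3 * e = of_int (eis_norm x)"
  shows "third_pow r e = eis_term r x"
  by (simp add: third_pow_def assms powi_eis_norm)

text \<open>The left-hand sum runs over the points \<open>(3 * m + 1, 3 * n)\<close>, those of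
  residue 1 with first coordinate 1 modulo 3. As \<open>rot\<close> permutes the three classes of
  the first coordinate cyclically, this is a third of \<open>theta_c r\<close>.\<close>

lemma infsum_third_pow_eq_theta_c:
  assumes "norm r < 1"
  shows "3 * (\<Sum>\<^sub>\<infinity>(m, n)\<in>(UNIV :: (int \<times> int) set).
        third_pow r (3 * ((of_int m + 1/3)\<^sup>2 + (of_int m + 1/3) * of_int n + (of_int n)\<^sup>2)))
    = theta_c r"
proof -
  let ?S = "\<lambda>k. {x \<in> res_one. fst x mod 3 = k mod 3}"
  have rot: "infsum (eis_term r) (?S k) = infsum (eis_term r) (?S (k - 1))" for k
  proof (rule infsum_reindex_bij_witness[of _ "\<lambda>x. rot (rot x)" rot])
    have step: "rot x \<in> ?S (l - 1)" if x: "x \<in> ?S l" for x l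
      using x res_one_rot(1)[of x] res_one_rot(2)[of x 0] mod_diff_cong[of "fst x" 3 l 1 1] by simp
    show "rot x \<in> ?S (k - 1)" if "x \<in> ?S k" for x
      using step[OF that] .
    have "(k - 1 - 1 - 1) mod 3 = k mod 3" by presburger
    then show "rot (rot x) \<in> ?S k" if "x \<in> ?S (k - 1)" for x
      using step[OF step[OF that]] by simp
  qed simp_all
  have "theta_c r = 3 * infsum (eis_term r) (?S 1)"
    using infsum_mod3_split[OF eis_term_summable[OF assms], of res_one fst] rot[of 2] rot[of 1]
    by (simp add: theta_c_def)
  also have "infsum (eis_term r) (?S 1) = (\<Sum>\<^sub>\<infinity>(m, n)\<in>(UNIV :: (int \<times> int) set).
        third_pow r (3 * ((of_int m + 1/3)\<^sup>2 + (of_int m + 1/3) * of_int n + (of_int n)\<^sup>2)))"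
  proof (rule infsum_reindex_bij_witness[symmetric,
      of _ "\<lambda>x. (fst x div 3, snd x div 3)" "\<lambda>(m, n). (3 * m + 1, 3 * n)"])
    fix x :: "int \<times> int" assume "x \<in> ?S 1"
    then have "fst x mod 3 = 1" "snd x mod 3 = 0"
      by (auto simp: eis_res_def) presburger
    then show "(case (fst x div 3, snd x div 3) of (m, n) \<Rightarrow> (3 * m + 1, 3 * n)) = x"
      by (cases x) (simp; presburger)
  next
    fix x :: "int \<times> int"
    obtain m n where x: "x = (m, n)" by force
    have "third_pow r (3 * ((of_int m + 1/3)\<^sup>2 + (of_int m + 1/3) * of_int n + (of_int n)\<^sup>2))
      = eis_term r (3 * m + 1, 3 * n)"
      by (rule third_pow_eis_norm) (simp add: eis_norm_def power2_eq_square field_simps)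
    then show "eis_term r (case x of (m, n) \<Rightarrow> (3 * m + 1, 3 * n)) = (case x of (m, n) \<Rightarrow>
        third_pow r (3 * ((of_int m + 1/3)\<^sup>2 + (of_int m + 1/3) * of_int n + (of_int n)\<^sup>2)))"
      by (simp add: x)
  qed (auto simp: eis_res_def, presburger+)
  finally show ?thesis ..
qed

text \<open>Multiplication by the Eisenstein integer \<theta>, not by a theta function.\<close>

definition theta_mult :: "int \<times> int \<Rightarrow> int \<times> int" where
  "theta_mult x = (fst x + 2 * snd x, - (2 * fst x + snd x))"

lemma eis_norm_theta_mult: "eis_norm (theta_mult x) = 3 * eis_norm x"
  by (simp add: eis_norm_def theta_mult_def power2_eq_square algebra_simps)

lemma eis_term_theta_mult: "eis_term q (theta_mult x) = eis_term (q ^ 3) x"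
proof -
  have "nat (3 * k) = 3 * nat k" for k :: int by simp
  then show ?thesis
    by (simp only: eis_term_def eis_norm_theta_mult power_mult)
qed

text \<open>Multiplication by \<open>-\<theta>\<close>, the conjugate of \<theta>, followed by
  division by 3, which is exact on multiples of \<theta>.\<close>

definition theta_div :: "int \<times> int \<Rightarrow> int \<times> int" where
  "theta_div y = (- ((fst y + 2 * snd y) div 3), (2 * fst y + snd y) div 3)"

lemma theta_div_mult [simp]: "theta_div (theta_mult x) = x"
  by (cases x) (simp add: theta_mult_def theta_div_def)

lemma theta_mult_div:
  assumes "eis_res y mod 3 = 0"
  shows "theta_mult (theta_div y) = y"
proof -
  obtain n k where y: "y = (n + 3 * k, n)"
  proof
    show "y = (snd y + 3 * (eis_res y div 3), snd y)"
      using assms by (simp add: eis_res_def prod_eq_iff minus_mod_eq_mult_div[symmetric])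
  qed
  have "y = theta_mult (- n - k, n + 2 * k)"
    by (simp add: y theta_mult_def)
  then show ?thesis by simp
qed

text \<open>Multiplication by \<theta> triples the norm and carries the class of 1 modulo \<theta>
  onto the class of \<theta> modulo 3; the coordinates of \<theta> are \<open>(1, -2)\<close>, both
  1 modulo 3.\<close>

lemma theta_c_cube_eq:
  "theta_c (r ^ 3) = infsum (eis_term r) {x. fst x mod 3 = 1 \<and> snd x mod 3 = 1}"
  unfolding theta_c_def
proof (rule infsum_reindex_bij_witness[of _ theta_div theta_mult])
  have theta_mult_iff: "theta_mult x \<in> {x. fst x mod 3 = 1 \<and> snd x mod 3 = 1} \<longleftrightarrow> x \<in> res_one" for x
    unfolding theta_mult_def fst_conv snd_conv mem_Collect_eq eis_res_def by presburger
  show "theta_mult x \<in> {x. fst x mod 3 = 1 \<and> snd x mod 3 = 1}" if "x \<in> res_one" for x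
    using that theta_mult_iff by blast
  fix y :: "int \<times> int" assume y: "y \<in> {x. fst x mod 3 = 1 \<and> snd x mod 3 = 1}"
  then have "eis_res y mod 3 = 0"
    using mod_diff_cong[of "fst y" 3 "snd y" "snd y" "snd y"] by (simp add: eis_res_def)
  then show "theta_mult (theta_div y) = y" by (rule theta_mult_div)
  then show "theta_div y \<in> res_one"
    using y theta_mult_iff[of "theta_div y"] by simp
qed (simp_all add: eis_term_theta_mult)

text \<open>The substitution \<open>n \<mapsto> n + m\<close> turns \<open>3m\<^sup>2 + 3mn + n\<^sup>2\<close> into \<open>m\<^sup>2 + mn + n\<^sup>2\<close>.\<close>

lemma infsum_third_pow_eq_theta_c':
  "(\<Sum>\<^sub>\<infinity>(m, n)\<in>(UNIV :: (int \<times> int) set).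
        third_pow r (3 * (3 * (of_int m + 1/3)\<^sup>2 + 3 * (of_int m + 1/3) * of_int n + (of_int n)\<^sup>2)))
    = theta_c (r ^ 3)"
  unfolding theta_c_cube_eq
proof (rule infsum_reindex_bij_witness[of _ "\<lambda>x. (fst x div 3, snd x div 3 - fst x div 3)"
    "\<lambda>(m, n). (3 * m + 1, 3 * (m + n) + 1)"])
  fix x :: "int \<times> int" assume "x \<in> {x. fst x mod 3 = 1 \<and> snd x mod 3 = 1}"
  then have "fst x mod 3 = 1" "snd x mod 3 = 1" by auto
  then show "(case (fst x div 3, snd x div 3 - fst x div 3) of (m, n) \<Rightarrow> (3 * m + 1, 3 * (m + n) + 1)) = x"
    by (cases x) (simp; presburger)
next
  fix x :: "int \<times> int"
  obtain m n where x: "x = (m, n)" by force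
  have "third_pow r (3 * (3 * (of_int m + 1/3)\<^sup>2 + 3 * (of_int m + 1/3) * of_int n + (of_int n)\<^sup>2))
    = eis_term r (3 * m + 1, 3 * (m + n) + 1)"
    by (rule third_pow_eis_norm) (simp add: eis_norm_def power2_eq_square field_simps)
  then show "eis_term r (case x of (m, n) \<Rightarrow> (3 * m + 1, 3 * (m + n) + 1)) = (case x of (m, n) \<Rightarrow>
      third_pow r (3 * (3 * (of_int m + 1/3)\<^sup>2 + 3 * (of_int m + 1/3) * of_int n + (of_int n)\<^sup>2)))"
    by (simp add: x)
qed (auto, presburger)

lemma infsum_eq_theta_a:
  "(\<Sum>\<^sub>\<infinity>(m, n)\<in>(UNIV :: (int \<times> int) set). q powi (m\<^sup>2 + m * n + n\<^sup>2)) = theta_a q"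
  unfolding theta_a_def
  by (rule infsum_cong) (simp only: case_prod_unfold eis_norm_def flip: powi_eis_norm)

lemma infsum_eq_theta_a':
  "(\<Sum>\<^sub>\<infinity>(m, n)\<in>(UNIV :: (int \<times> int) set). q powi (3 * (3 * m\<^sup>2 + 3 * m * n + n\<^sup>2))) = theta_a (q ^ 3)"
  unfolding theta_a_def
proof (rule infsum_reindex_bij_witness[of _ "\<lambda>(m, n). (m, n - m)" "\<lambda>(m, n). (m, n + m)"])
  fix x :: "int \<times> int"
  obtain m n where x: "x = (m, n)" by force
  have "eis_norm (m, n + m) = 3 * m\<^sup>2 + 3 * m * n + n\<^sup>2"
    by (simp add: eis_norm_def power2_eq_square algebra_simps)
  then show "eis_term (q ^ 3) (case x of (m, n) \<Rightarrow> (m, n + m))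
      = (case x of (m, n) \<Rightarrow> q powi (3 * (3 * m\<^sup>2 + 3 * m * n + n\<^sup>2)))"
    by (simp only: x prod.case power_int_mult power_int_numeral flip: powi_eis_norm)
qed auto

lemma infsum_eq_theta_b:
  "(\<Sum>\<^sub>\<infinity>(m, n)\<in>(UNIV :: (int \<times> int) set). w powi (m - n) * q powi (m\<^sup>2 + m * n + n\<^sup>2)) = theta_b w q"
  unfolding theta_b_def
  by (rule infsum_cong) (simp only: case_prod_unfold eis_norm_def eis_res_def flip: powi_eis_norm)

text \<open>The character \<open>\<omega>\<^bsup>-(m + n)\<^esup>\<close> is multiplied by \<open>\<omega>\<^bsup>-k\<^esup>\<close> under \<open>rot\<close> on the residue class \<open>k\<close> modulo
  \<open>\<theta>\<close>, so only the class of the multiples of \<open>\<theta>\<close> contributes.\<close>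

lemma infsum_eq_theta_b':
  assumes q: "norm q < 1" and w: "w ^ 3 = 1" "w \<noteq> 1"
  shows "(\<Sum>\<^sub>\<infinity>(m, n)\<in>(UNIV :: (int \<times> int) set). w powi (m - n) * q powi (3 * m\<^sup>2 + 3 * m * n + n\<^sup>2))
    = theta_b w (q ^ 3)"
proof -
  have w0: "w \<noteq> 0" using w by auto
  define f where "f = (\<lambda>x. w powi (- (fst x + snd x)) * eis_term q x)"
  have f: "f summable_on UNIV"
    by (rule abs_summable_summable)
      (use eis_term_abs_summable[OF q, of UNIV] norm_eq_1_of_cube_eq_1[OF w(1)] in \<open>simp add: f_def norm_mult norm_power_int\<close>)
  have "(\<Sum>\<^sub>\<infinity>(m, n)\<in>(UNIV :: (int \<times> int) set). w powi (m - n) * q powi (3 * m\<^sup>2 + 3 * m * n + n\<^sup>2))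
      = infsum f UNIV"
  proof (rule infsum_reindex_bij_witness[of _ "\<lambda>(m, n). (m, n - m)" "\<lambda>(m, n). (m, n + m)"])
    fix x :: "int \<times> int"
    obtain m n where x: "x = (m, n)" by force
    \<comment> \<open>The two exponents differ by \<open>3 * m\<close>.\<close>
    have "w powi (- (m + (n + m))) = w powi (m - n)"
      by (rule powi_cong_mod3[OF w(1)]) presburger
    then show "f (case x of (m, n) \<Rightarrow> (m, n + m))
      = (case x of (m, n) \<Rightarrow> w powi (m - n) * q powi (3 * m\<^sup>2 + 3 * m * n + n\<^sup>2))"
      by (simp add: x f_def eis_norm_def power2_eq_square algebra_simps flip: powi_eis_norm)
  qed auto
  moreover have vanish: "infsum f {x. eis_res x mod 3 = k} = 0" if "k \<in> {1, 2}" for k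
  proof -
    have "infsum f {x. eis_res x mod 3 = k} = infsum (\<lambda>x. w powi (- k) * f x) {x. eis_res x mod 3 = k}"
    proof (rule infsum_reindex_bij_witness[of _ rot "\<lambda>x. rot (rot x)"])
      fix x assume "x \<in> {x. eis_res x mod 3 = k}"
      then have x: "(fst x - snd x) mod 3 = k" by (simp add: eis_res_def)
      have "w powi (- k + - (fst (rot (rot x)) + snd (rot (rot x)))) = w powi (- (fst x + snd x))"
        by (rule powi_cong_mod3[OF w(1)]) (simp add: rot_def flip: x, presburger)
      then show "w powi (- k) * f (rot (rot x)) = f x"
        by (simp only: f_def eis_term_rot mult.assoc[symmetric] power_int_add[OF disjI1[OF w0], symmetric])
    qed (simp_all add: eis_res_rot)
    also have "\<dots> = w powi (- k) * infsum f {x. eis_res x mod 3 = k}"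
      by (rule infsum_cmult_right')
    finally have "(1 - w powi (- k)) * infsum f {x. eis_res x mod 3 = k} = 0"
      \<comment> \<open>The sum over the class equals \<open>w powi (- k)\<close> times itself, and
        this factor is not 1.\<close>
      unfolding left_diff_distrib mult_1_left right_minus_eq .
    moreover have "w powi k \<noteq> 1"
      using that w w0 by (auto simp: power3_eq_cube power2_eq_square)
    ultimately show ?thesis
      by (simp add: power_int_minus inverse_eq_1_iff)
  qed
  moreover have "infsum f {x. eis_res x mod 3 = 0} = theta_b w (q ^ 3)"
    unfolding theta_b_def
  proof (rule infsum_reindex_bij_witness[of _ theta_mult theta_div])
    fix x :: "int \<times> int"
    show "theta_mult x \<in> {x. eis_res x mod 3 = 0}"
      unfolding theta_mult_def fst_conv snd_conv mem_Collect_eq eis_res_def by presburger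
  next
    \<comment> \<open>The negated coordinate sum of \<theta>\<open>x\<close> is exactly the residue
      \<open>fst x - snd x\<close>.\<close>
    have w_mult: "w powi eis_res x = w powi (- (fst (theta_mult x) + snd (theta_mult x)))" for x
      by (rule powi_cong_mod3[OF w(1)]) (simp add: theta_mult_def eis_res_def)
    fix y assume "y \<in> {x. eis_res x mod 3 = 0}"
    then show y: "theta_mult (theta_div y) = y"
      by (simp add: theta_mult_div)
    show "w powi (eis_res (theta_div y)) * eis_term (q ^ 3) (theta_div y) = f y"
      by (simp only: f_def y w_mult flip: eis_term_theta_mult)
  qed simp_all
  ultimately show ?thesis
    using infsum_mod3_split[OF f, of eis_res] by simp
qed

theorem theorem6p1:
  fixes q r \<omega> :: complex
  assumes "norm q < 1"
    and "r ^ 3 = q"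
    and "\<omega> = exp (2 * of_real pi * \<i> / 3)"
  shows
    "(\<Sum>\<^sub>\<infinity>(m, n)\<in>(UNIV :: (int \<times> int) set).
        \<omega> powi (m - n) * q powi (m\<^sup>2 + m * n + n\<^sup>2)) ^ 3
     + (3 * (\<Sum>\<^sub>\<infinity>(m, n)\<in>(UNIV :: (int \<times> int) set).
        third_pow r (3 * ((of_int m + 1/3)\<^sup>2 + (of_int m + 1/3) * of_int n + (of_int n)\<^sup>2)))) ^ 3
     = (\<Sum>\<^sub>\<infinity>(m, n)\<in>(UNIV :: (int \<times> int) set).
        q powi (m\<^sup>2 + m * n + n\<^sup>2)) ^ 3
     \<and>
     (\<Sum>\<^sub>\<infinity>(m, n)\<in>(UNIV :: (int \<times> int) set).
        \<omega> powi (m - n) * q powi (3 * m\<^sup>2 + 3 * m * n + n\<^sup>2)) ^ 3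
     + (\<Sum>\<^sub>\<infinity>(m, n)\<in>(UNIV :: (int \<times> int) set).
        third_pow r (3 * (3 * (of_int m + 1/3)\<^sup>2 + 3 * (of_int m + 1/3) * of_int n + (of_int n)\<^sup>2))) ^ 3
     = (\<Sum>\<^sub>\<infinity>(m, n)\<in>(UNIV :: (int \<times> int) set).
        q powi (3 * (3 * m\<^sup>2 + 3 * m * n + n\<^sup>2))) ^ 3"
proof -
  have w: "\<omega> ^ 3 = 1"
    unfolding assms(3) exp_of_nat_mult[symmetric] using exp_two_pi_i by (simp add: mult_ac)
  have "Im \<omega> = sin (2 * pi / 3)"
    by (simp add: assms(3) Im_exp)
  also have "\<dots> > 0"
    by (rule sin_gt_zero) (use pi_gt_zero in linarith)+
  finally have w1: "\<omega> \<noteq> 1" by auto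
  have "norm r ^ 3 < 1"
    using assms(1,2) by (metis norm_power)
  then have r: "norm r < 1"
    by (simp add: power_less_one_iff)
  show ?thesis
    \<comment> \<open>The first identity takes \<open>r\<close> as cube root of \<open>q\<close>,
      the second takes \<open>q\<close> as cube root of \<open>q ^ 3\<close>.\<close>
    using cubic_theta_identity[OF r w w1] cubic_theta_identity[OF assms(1) w w1] assms(2)
    by (simp only: infsum_eq_theta_a infsum_eq_theta_a' infsum_eq_theta_b infsum_eq_theta_b'[OF assms(1) w w1]
        infsum_third_pow_eq_theta_c[OF r] infsum_third_pow_eq_theta_c')
qed

end
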